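(* Let $\mathscr{H}_S$ be a finite-dimensional complex Hilbert space, let $\Phi:\mathcal{B}(\mathscr{H}_S)\to\mathcal{B}(\mathscr{H}_S)$ be an affine map, decomposed as $\Phi[X]=\mathcal{L}[X]+B$ with $\mathcal{L}:\mathcal{B}(\mathscr{H}_S)\to\mathcal{B}(\mathscr{H}_S)$ linear and $B\in\mathcal{B}(\mathscr{H}_S)$ fixed, and define the linear map $\Psi[X]=\mathcal{L}[X]+B\,\mathrm{Tr}\{X\}$ for $X\in\mathcal{B}(\mathscr{H}_S)$. Let $\Lambda:\mathcal{B}(\mathscr{H}_S)\to\mathcal{B}(\mathscr{H}_S)$ be a linear map satisfying $\Lambda[X]=\Phi[X]$ for all $X\in\mathcal{A}^1(\mathscr{H}_S)$. Then $\Lambda[X]=\Psi[X]$ for all $X\in\mathcal{B}(\mathscr{H}_S)$; i.e. $\Psi$ is the unique linear extension of $\Phi$ from $\mathcal{A}^1(\mathscr{H}_S)$ to $\mathcal{B}(\mathscr{H}_S)$.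
   Context: $\mathcal{B}(\mathscr{H}_S)$ is the complex vector space of (bounded) linear operators on $\mathscr{H}_S$, and $\mathcal{A}^1(\mathscr{H}_S)=\{X\in\mathcal{B}(\mathscr{H}_S)\mid \mathrm{Tr}\{X\}=1\}$ is the affine subspace of trace-one operators. Linear means complex-linear. *)

theory Defs
  imports "HOL-Analysis.Analysis"
begin

class scaleC =
  fixes scaleC :: "complex \<Rightarrow> 'a \<Rightarrow> 'a" (infixr "*\<^sub>C" 75)

class complex_vector = scaleC + ab_group_add +
  assumes scaleC_add_right: "a *\<^sub>C (x + y) = a *\<^sub>C x + a *\<^sub>C y"
    and scaleC_add_left: "(a + b) *\<^sub>C x = a *\<^sub>C x + b *\<^sub>C x"
    and scaleC_scaleC: "a *\<^sub>C b *\<^sub>C x = (a * b) *\<^sub>C x"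
    and scaleC_one: "1 *\<^sub>C x = x"

global_interpretation cvec: vector_space "scaleC :: complex \<Rightarrow> 'a \<Rightarrow> 'a::complex_vector"
  by unfold_locales (simp_all add: scaleC_add_right scaleC_add_left scaleC_scaleC scaleC_one)

abbreviation clinear :: "('a::complex_vector \<Rightarrow> 'b::complex_vector) \<Rightarrow> bool"
  where "clinear \<equiv> Vector_Spaces.linear scaleC scaleC"

text \<open>The inner product is antilinear in the first argument and linear in the second. Its real
  part is the library's real inner product, so the library's norm is the Hilbert space norm.\<close>

class complex_inner = complex_vector + real_inner +
  fixes cinner :: "'a \<Rightarrow> 'a \<Rightarrow> complex"
  assumes scaleR_scaleC: "r *\<^sub>R x = complex_of_real r *\<^sub>C x"
    and cinner_commute: "cinner x y = cnj (cinner y x)"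
    and cinner_add_right: "cinner x (y + z) = cinner x y + cinner x z"
    and cinner_scaleC_right: "cinner x (c *\<^sub>C y) = c * cinner x y"
    and inner_eq_Re_cinner: "inner x y = Re (cinner x y)"

class chilbert_space = complex_inner + complete_space

class findim_chilbert = chilbert_space +
  assumes finite_spanning_set: "\<exists>S. finite S \<and> (\<forall>x. \<exists>c. x = (\<Sum>v\<in>S. c v *\<^sub>C v))"

lemma clinear_iff:
  "clinear f \<longleftrightarrow> (\<forall>x y. f (x + y) = f x + f y) \<and> (\<forall>c x. f (c *\<^sub>C x) = c *\<^sub>C f x)"
  by (simp add: Vector_Spaces.linear_iff cvec.vector_space_axioms)

lemma norm_scaleC: "norm (c *\<^sub>C x) = cmod c * norm x" for x :: "'a::complex_inner"
proof -
  have "cinner (c *\<^sub>C x) (c *\<^sub>C x) = (c * cnj c) * cinner x x"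
    by (metis cinner_commute cinner_scaleC_right complex_cnj_mult mult.assoc)
  also have "c * cnj c = complex_of_real ((cmod c)\<^sup>2)"
    by (metis complex_norm_square)
  finally have "(norm (c *\<^sub>C x))\<^sup>2 = (cmod c * norm x)\<^sup>2"
    by (simp add: power2_norm_eq_inner inner_eq_Re_cinner power_mult_distrib)
  then show ?thesis
    by (simp add: power2_eq_iff_nonneg)
qed

lemma bounded_linear_scaleC:
  "bounded_linear (\<lambda>x::'a::complex_inner. c *\<^sub>C x)"
  by (rule bounded_linear_intro[where K = "cmod c"])
    (simp_all add: scaleC_add_right scaleR_scaleC scaleC_scaleC norm_scaleC mult.commute)

typedef (overloaded) 'a operator = "{X :: 'a::complex_inner \<Rightarrow> 'a. clinear X \<and> bounded_linear X}"
  morphisms op_apply Operator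
  by (intro exI[of _ "\<lambda>x. 0"]) (simp add: clinear_iff)

setup_lifting type_definition_operator

instantiation operator :: (complex_inner) complex_vector
begin

lift_definition zero_operator :: "'a operator" is "\<lambda>x. 0"
  by (simp add: clinear_iff)

lift_definition plus_operator :: "'a operator \<Rightarrow> 'a operator \<Rightarrow> 'a operator"
  is "\<lambda>X Y x. X x + Y x"
  by (simp add: clinear_iff bounded_linear_add scaleC_add_right algebra_simps)

lift_definition minus_operator :: "'a operator \<Rightarrow> 'a operator \<Rightarrow> 'a operator"
  is "\<lambda>X Y x. X x - Y x"
  by (simp add: clinear_iff bounded_linear_sub cvec.scale_right_diff_distrib algebra_simps)

lift_definition uminus_operator :: "'a operator \<Rightarrow> 'a operator" is "\<lambda>X x. - X x"
  by (simp add: clinear_iff bounded_linear_minus)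

lift_definition scaleC_operator :: "complex \<Rightarrow> 'a operator \<Rightarrow> 'a operator" is "\<lambda>c X x. c *\<^sub>C X x"
  by (simp add: clinear_iff scaleC_add_right scaleC_scaleC mult.commute
      bounded_linear_compose[OF bounded_linear_scaleC])

instance
  by standard
    (transfer; simp add: algebra_simps scaleC_add_right scaleC_add_left scaleC_scaleC scaleC_one)+

end

definition is_cbasis :: "'a::complex_vector set \<Rightarrow> bool"
  where "is_cbasis E \<longleftrightarrow> finite E \<and> cvec.independent E \<and> cvec.span E = UNIV"

lemma is_cbasis_exists: "\<exists>E :: 'a::findim_chilbert set. is_cbasis E"
proof -
  obtain S :: "'a set" where S: "finite S" "cvec.span S = UNIV"
  proof -
    obtain S :: "'a set" where fin: "finite S"
      and S: "\<And>x. \<exists>c. x = (\<Sum>v\<in>S. c v *\<^sub>C v)"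
      using finite_spanning_set by metis
    have "x \<in> cvec.span S" for x
    proof -
      obtain c where "x = (\<Sum>v\<in>S. c v *\<^sub>C v)"
        using S by blast
      then show ?thesis
        by (simp add: cvec.span_sum cvec.span_scale cvec.span_base)
    qed
    with fin that show ?thesis by blast
  qed
  obtain E where "E \<subseteq> S" "cvec.independent E" "S \<subseteq> cvec.span E"
    using cvec.maximal_independent_subset[of S] by blast
  then have "is_cbasis E"
    unfolding is_cbasis_def
    using S cvec.span_minimal[of S "cvec.span E"] finite_subset by auto
  then show ?thesis ..
qed

text \<open>The sum of the diagonal entries of the matrix of the operator with respect to a basis;
  the lemmas below show that the choice of the basis does not matter and that for an orthonormal
  basis it is the sum of the \<open>\<langle>e, X e\<rangle>\<close>.\<close>

definition op_trace :: "'a::findim_chilbert operator \<Rightarrow> complex"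
  where "op_trace X =
    (let E = (SOME E. is_cbasis E) in \<Sum>e\<in>E. cvec.representation E (op_apply X e) e)"

lemma clinear_op_apply: "clinear (op_apply X)"
  using op_apply[of X] by simp

lemma cbasis_expand:
  assumes "is_cbasis E"
  shows "(\<Sum>e\<in>E. cvec.representation E x e *\<^sub>C e) = x"
  using assms by (intro cvec.sum_representation_eq) (auto simp: is_cbasis_def)

lemma representation_clinear:
  assumes E: "is_cbasis E" and F: "is_cbasis F" and f: "clinear f"
  shows "cvec.representation E (f x) e =
    (\<Sum>u\<in>F. cvec.representation F x u * cvec.representation E (f u) e)"
proof -
  interpret f: Vector_Spaces.linear scaleC scaleC f by (rule f)
  have "f x = f (\<Sum>u\<in>F. cvec.representation F x u *\<^sub>C u)"
    by (simp add: cbasis_expand[OF F])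
  also have "\<dots> = (\<Sum>u\<in>F. cvec.representation F x u *\<^sub>C f u)"
    by (simp add: f.sum f.scale)
  finally show ?thesis
    using E by (simp add: is_cbasis_def cvec.representation_sum cvec.representation_scale)
qed

lemma op_trace_cbasis:
  assumes F: "is_cbasis F"
  shows "op_trace X = (\<Sum>u\<in>F. cvec.representation F (op_apply X u) u)"
proof -
  define E :: "'a set" where "E = (SOME E. is_cbasis E)"
  have E: "is_cbasis E"
    unfolding E_def using is_cbasis_exists by (rule someI_ex)
  let ?f = "op_apply X" and ?e = "cvec.representation E" and ?u = "cvec.representation F"
  have id: "clinear (\<lambda>x::'a. x)"
    by (simp add: clinear_iff)
  have "op_trace X = (\<Sum>e\<in>E. ?e (?f e) e)"
    by (simp add: op_trace_def E_def Let_def)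
  also have "\<dots> = (\<Sum>e\<in>E. \<Sum>u\<in>F. ?u e u * ?e (?f u) e)"
    by (intro sum.cong refl representation_clinear[OF E F clinear_op_apply])
  also have "\<dots> = (\<Sum>u\<in>F. \<Sum>e\<in>E. ?e (?f u) e * ?u e u)"
    by (subst sum.swap) (simp add: mult.commute)
  also have "\<dots> = (\<Sum>u\<in>F. ?u (?f u) u)"
    by (intro sum.cong refl representation_clinear[OF F E id, symmetric])
  finally show ?thesis .
qed

lemma op_trace_orthonormal:
  assumes F: "is_cbasis F"
    and orth: "\<And>u v. u \<in> F \<Longrightarrow> v \<in> F \<Longrightarrow> cinner u v = (if u = v then 1 else 0)"
  shows "op_trace X = (\<Sum>u\<in>F. cinner u (op_apply X u))"
proof -
  have fin: "finite F"
    using F by (simp add: is_cbasis_def)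
  have "cvec.representation F x u = cinner u x" if u: "u \<in> F" for x u
  proof -
    have lin: "Modules.additive (cinner u)"
      by (simp add: Modules.additive_def cinner_add_right)
    have "cinner u x = cinner u (\<Sum>v\<in>F. cvec.representation F x v *\<^sub>C v)"
      by (simp add: cbasis_expand[OF F])
    also have "\<dots> = (\<Sum>v\<in>F. cvec.representation F x v * cinner u v)"
      by (simp add: additive.sum[OF lin] cinner_scaleC_right)
    also have "\<dots> = (\<Sum>v\<in>F. if v = u then cvec.representation F x v else 0)"
      using u orth by (intro sum.cong) auto
    also have "\<dots> = cvec.representation F x u"
      using u fin by simp
    finally show ?thesis by simp
  qed
  then show ?thesis
    by (simp add: op_trace_cbasis[OF F])
qed

definition trace_one_operators :: "'a::findim_chilbert operator set"
  where "trace_one_operators = {X. op_trace X = 1}"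

end

(*  On a nonzero space the identity has trace dim H, which is nonzero, so its normalisation T has
    trace one. Every X equals Y + (Tr X - 1) T with Y of trace one, so linear maps that agree on
    the trace-one operators agree at X. On the zero space there are no trace-one operators, but 0
    is the only operator. *)
theory Submission
  imports Defs
begin

text \<open>Since the trace is basis-independent, one basis \<open>E\<close> serves
  \<open>X\<close>, \<open>Y\<close> and their combinations; coordinates with respect to
  \<open>E\<close> are linear.\<close>

lemma op_trace_linear:
  fixes X Y :: "'a::findim_chilbert operator"
  shows
  "op_trace (X + Y) = op_trace X + op_trace Y" "op_trace (c *\<^sub>C X) = c * op_trace X"
proof -
  obtain E :: "'a set" where E: "is_cbasis E"
    using is_cbasis_exists by blast
  show "op_trace (X + Y) = op_trace X + op_trace Y" "op_trace (c *\<^sub>C X) = c * op_trace X"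
    using E by (simp_all add: op_trace_cbasis[OF E] is_cbasis_def plus_operator.rep_eq
        scaleC_operator.rep_eq cvec.representation_add cvec.representation_scale
        sum.distrib sum_distrib_left)
qed

lift_definition id_operator :: "'a::complex_inner operator" is "\<lambda>x. x"
  by (simp add: clinear_iff)

lemma op_trace_id_operator:
  assumes E: "is_cbasis (E :: 'a::findim_chilbert set)"
  shows "op_trace (id_operator :: 'a operator) = of_nat (card E)"
  using E by (simp add: op_trace_cbasis[OF E] id_operator.rep_eq is_cbasis_def
      cvec.representation_basis)

text \<open>A nonzero operator serves as witness that the space is nontrivial.\<close>

lemma trace_one_operator_exists:
  assumes "(X :: 'a::findim_chilbert operator) \<noteq> 0"
  shows "\<exists>T :: 'a operator. op_trace T = 1"
proof -
  obtain E :: "'a set" where E: "is_cbasis E"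
    using is_cbasis_exists by blast
  have "E \<noteq> {}"
  proof
    assume "E = {}"
    \<comment> \<open>The empty set spans only 0, so every value of \<open>X\<close>
      vanishes.\<close>
    with E have "x = 0" for x :: 'a
      by (auto simp: is_cbasis_def)
    then have "X = 0"
      by (intro op_apply_inject[THEN iffD1] ext) (metis)
    with assms show False by simp
  qed
  with E have "card E \<noteq> 0"
    by (simp add: is_cbasis_def)
  then have "op_trace ((1 / of_nat (card E)) *\<^sub>C (id_operator :: 'a operator)) = 1"
    by (simp add: op_trace_linear op_trace_id_operator[OF E])
  then show ?thesis ..
qed

lemma clinear_eq_if_eq_on_trace_one:
  fixes f g :: "'a::findim_chilbert operator \<Rightarrow> 'b::complex_vector"
  assumes f: "clinear f" and g: "clinear g"
    and eq: "\<And>X. X \<in> trace_one_operators \<Longrightarrow> f X = g X"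
  shows "f X = g X"
proof (cases "X = 0")
  \<comment> \<open>Kept apart because on the zero space \<open>eq\<close> is vacuous; linearity
    alone gives the value at 0.\<close>
  case True
  then show ?thesis
    using f g by (metis clinear_iff cvec.scale_zero_left)
next
  case False
  then obtain T :: "'a operator" where T: "op_trace T = 1"
    using trace_one_operator_exists by blast
  \<comment> \<open>Shifting by a multiple of \<open>T\<close>, rather than rescaling
    \<open>X\<close>, also works when \<open>X\<close> has trace 0.\<close>
  define c where "c = op_trace X - 1"
  define Y where "Y = X + (- c) *\<^sub>C T"
  have "op_trace Y = 1"
    by (simp add: Y_def c_def op_trace_linear T)
  then have "f Y = g Y" "f T = g T"
    using T by (simp_all add: eq trace_one_operators_def)
  moreover have "X = Y + c *\<^sub>C T"
    by (simp add: Y_def)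
  ultimately show ?thesis
    using f g by (simp add: clinear_iff)
qed

theorem theorem1:
  fixes \<Phi> \<L> \<Psi> :: "'h::findim_chilbert operator \<Rightarrow> 'h operator"
    and B :: "'h operator"
  assumes linear: "clinear \<L>"
    and \<Phi>: "\<And>X. \<Phi> X = \<L> X + B"
    and \<Psi>: "\<And>X. \<Psi> X = \<L> X + op_trace X *\<^sub>C B"
  shows "clinear \<Psi> \<and> (\<forall>X\<in>trace_one_operators. \<Psi> X = \<Phi> X) \<and>
    (\<forall>\<Lambda> :: 'h operator \<Rightarrow> 'h operator.
      clinear \<Lambda> \<and> (\<forall>X\<in>trace_one_operators. \<Lambda> X = \<Phi> X) \<longrightarrow> (\<forall>X. \<Lambda> X = \<Psi> X))"
proof -
  have lin: "clinear \<Psi>"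
    using linear by (simp add: clinear_iff \<Psi> op_trace_linear scaleC_add_left scaleC_add_right
        scaleC_scaleC add_ac)
  moreover have ext: "\<forall>X\<in>trace_one_operators. \<Psi> X = \<Phi> X"
    \<comment> \<open>At trace one the coefficient of \<open>B\<close> is 1, which restores the
      constant term of \<Phi>.\<close>
    by (simp add: \<Phi> \<Psi> trace_one_operators_def scaleC_one)
  moreover have "\<Lambda> X = \<Psi> X"
    if "clinear \<Lambda>" "\<forall>X\<in>trace_one_operators. \<Lambda> X = \<Phi> X" for \<Lambda> X
    \<comment> \<open>Both linear maps agree with \<Phi>, hence with each other, on the trace-one
      operators.\<close>
    using clinear_eq_if_eq_on_trace_one[OF that(1) lin] that(2) ext by simp
  ultimately show ?thesis by blast
qed

end
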